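(* Let $d>k\geq1$, $\varepsilon\in(0,1)$, $A\succeq0$ symmetric with $\lambda_k>\lambda_{k+1}$, $\beta>0$ with $\lambda_k>2\sqrt\beta\geq\lambda_{k+1}$, $X_0\in\mathrm{St}(d,k)$ with $\cos\theta_k(U_k,X_0)>0$, and ANPM perturbations satisfying for all $t\geq0$: $\|U_{-k}^\top\Xi_t\|_2\leq c(\lambda_k-2\sqrt\beta)\varepsilon$ and $\|U_k^\top\Xi_t\|_2\leq c(\lambda_k-2\sqrt\beta)\cos\theta_k(U_k,X_t)$, $c=1/32$. Then for all $t\geq1$ and all $s\in\{0,\dots,t-1\}$, $$\|C_t^{-1}\|_2\leq\frac{c_1}{((1-c)\lambda_k^++c\sqrt\beta)^t},\quad \|C_{t-1-s}C_t^{-1}\|_2\leq\frac{c_1}{((1-c)\lambda_k^++c\sqrt\beta)^{s+1}},$$ $$\|p_t(\Lambda_{-k})\|_2\leq\sqrt\beta^{\,t},\quad \|q_t(\Lambda_{-k})\|_2\leq(t+1)\sqrt\beta^{\,t},$$ where $c_1:=31/15$ and $\lambda_k^+:=\frac{\lambda_k+\sqrt{\lambda_k^2-4\beta}}{2}$.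
   Context: $A$ has eigenvalues $\lambda_1\geq\dots\geq\lambda_d\geq0$, orthonormal eigenvectors $u_i$; $U_k:=[u_1..u_k]$, $U_{-k}:=[u_{k+1}..u_d]$, $\Lambda_k:=\mathrm{diag}(\lambda_1..\lambda_k)$, $\Lambda_{-k}:=\mathrm{diag}(\lambda_{k+1}..\lambda_d)$. QR: $Y=XR$, $X^\top X=I_k$, $R$ upper triangular, nonnegative diagonal; $\theta_k(U,X):=\arccos\sigma_{\min}(U^\top X)$. ANPM: $(X_1,R_1)=\mathrm{QR}(\tfrac12AX_0+\Xi_0)$; for $t\geq1$, $Y_{t+1}=AX_t-\beta X_{t-1}R_t^{-1}+\Xi_t$, $(X_{t+1},R_{t+1})=\mathrm{QR}(Y_{t+1})$. $E_t:=\Lambda_k^{-1}(U_k^\top\Xi_t)(U_k^\top X_t)^{-1}$; $G_0:=(I_k/2+E_0)^{-1}$, $G_{t+1}:=(I_k-\beta\Lambda_k^{-1}G_t\Lambda_k^{-1}+E_{t+1})^{-1}$; $C_0:=I_k$, $C_t:=\Lambda_kG_{t-1}^{-1}\Lambda_kG_{t-2}^{-1}\cdots\Lambda_kG_0^{-1}$. Polynomials: $p_0=1$, $p_1(x)=x/2$, $p_{t+1}=xp_t-\beta p_{t-1}$; $q_0=1$, $q_1(x)=x$, $q_{t+1}=xq_t-\beta q_{t-1}$. *)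

theory Defs
  imports Complex_Main "Jordan_Normal_Form.Matrix"
begin

definition vnorm :: "real vec \<Rightarrow> real" where
  "vnorm v = sqrt (scalar_prod v v)"

definition spec_norm :: "real mat \<Rightarrow> real" where
  "spec_norm M = Sup {vnorm (M *\<^sub>v x) | x. x \<in> carrier_vec (dim_col M) \<and> vnorm x \<le> 1}"

definition sigma_min :: "real mat \<Rightarrow> real" where
  "sigma_min M = Inf {vnorm (M *\<^sub>v x) | x. x \<in> carrier_vec (dim_col M) \<and> vnorm x = 1}"

definition cos_theta :: "real mat \<Rightarrow> real mat \<Rightarrow> real" where
  "cos_theta U X = cos (arccos (sigma_min (U\<^sup>T * X)))"

(* matrix inverse (total: zero matrix if not invertible) *)
definition minv :: "real mat \<Rightarrow> real mat" where
  "minv M = (if \<exists>N. N \<in> carrier_mat (dim_row M) (dim_row M) \<and> inverts_mat M N \<and> inverts_mat N M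
             then (SOME N. N \<in> carrier_mat (dim_row M) (dim_row M) \<and> inverts_mat M N \<and> inverts_mat N M)
             else 0\<^sub>m (dim_row M) (dim_row M))"

definition is_QR :: "real mat \<Rightarrow> real mat \<Rightarrow> real mat \<Rightarrow> bool" where
  "is_QR Y X R \<longleftrightarrow> X \<in> carrier_mat (dim_row Y) (dim_col Y) \<and> R \<in> carrier_mat (dim_col Y) (dim_col Y)
     \<and> Y = X * R \<and> X\<^sup>T * X = 1\<^sub>m (dim_col Y) \<and> upper_triangular R \<and> (\<forall>i < dim_col Y. R $$ (i,i) \<ge> 0)"

(* U_k = [u_1 .. u_k] and U_{-k} = [u_{k+1} .. u_d] (columns of U, 0-indexed) *)
definition Ufirst :: "real mat \<Rightarrow> nat \<Rightarrow> real mat" where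
  "Ufirst U k = mat (dim_row U) k (\<lambda>(i,j). U $$ (i,j))"

definition Urest :: "real mat \<Rightarrow> nat \<Rightarrow> real mat" where
  "Urest U k = mat (dim_row U) (dim_col U - k) (\<lambda>(i,j). U $$ (i, k + j))"

(* Lambda_k = diag(lambda_1..lambda_k), Lambda_{-k} = diag(lambda_{k+1}..lambda_d); lam is 1-indexed *)
definition Lfirst :: "(nat \<Rightarrow> real) \<Rightarrow> nat \<Rightarrow> real mat" where
  "Lfirst lam k = mat k k (\<lambda>(i,j). if i = j then lam (i + 1) else 0)"

definition Lrest :: "(nat \<Rightarrow> real) \<Rightarrow> nat \<Rightarrow> nat \<Rightarrow> real mat" where
  "Lrest lam d k = mat (d - k) (d - k) (\<lambda>(i,j). if i = j then lam (k + 1 + i) else 0)"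

definition Emat :: "real mat \<Rightarrow> real mat \<Rightarrow> real mat \<Rightarrow> real mat \<Rightarrow> real mat" where
  "Emat L Uk Xi X = minv L * (Uk\<^sup>T * Xi) * minv (Uk\<^sup>T * X)"

fun Gmat :: "real \<Rightarrow> real mat \<Rightarrow> (nat \<Rightarrow> real mat) \<Rightarrow> nat \<Rightarrow> real mat" where
  "Gmat beta L E 0 = minv ((1/2) \<cdot>\<^sub>m 1\<^sub>m (dim_row L) + E 0)"
| "Gmat beta L E (Suc t) =
     minv (1\<^sub>m (dim_row L) - beta \<cdot>\<^sub>m (minv L * Gmat beta L E t * minv L) + E (Suc t))"

fun Cmat :: "real mat \<Rightarrow> (nat \<Rightarrow> real mat) \<Rightarrow> nat \<Rightarrow> real mat" where
  "Cmat L G 0 = 1\<^sub>m (dim_row L)"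
| "Cmat L G (Suc t) = L * minv (G t) * Cmat L G t"

fun pmat :: "real \<Rightarrow> real mat \<Rightarrow> nat \<Rightarrow> real mat" where
  "pmat beta M 0 = 1\<^sub>m (dim_row M)"
| "pmat beta M (Suc 0) = (1/2) \<cdot>\<^sub>m M"
| "pmat beta M (Suc (Suc t)) = M * pmat beta M (Suc t) - beta \<cdot>\<^sub>m pmat beta M t"

fun qmat :: "real \<Rightarrow> real mat \<Rightarrow> nat \<Rightarrow> real mat" where
  "qmat beta M 0 = 1\<^sub>m (dim_row M)"
| "qmat beta M (Suc 0) = M"
| "qmat beta M (Suc (Suc t)) = M * qmat beta M (Suc t) - beta \<cdot>\<^sub>m qmat beta M t"

end

theory Submission
  imports Defs "HOL-Analysis.L2_Norm" "Jordan_Normal_Form.Determinant"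
begin

text \<open>The matrices \<open>C\<^sub>t\<close> are products of factors \<open>\<Lambda>\<^sub>k G\<^sub>s\<^sup>-\<^sup>1\<close>, so \<open>C\<^sub>m C\<^sub>m\<^sub>+\<^sub>n\<^sup>-\<^sup>1\<close> is a product
  of the \<open>n\<close> factors \<open>G\<^sub>s \<Lambda>\<^sub>k\<^sup>-\<^sup>1\<close>, and it suffices to show \<open>\<parallel>G\<^sub>s\<parallel> \<le> \<lambda>\<^sub>k / r\<^sub>s\<close> for
  suitable \<open>r\<^sub>s > 0\<close>. The perturbation bound gives \<open>\<parallel>E\<^sub>t\<parallel> \<le> \<delta> / \<lambda>\<^sub>k\<close> with
  \<open>\<delta> = (\<lambda>\<^sub>k - 2 \<surd>\<beta>) / 32\<close>, so each \<open>G\<^sub>t\<^sup>-\<^sup>1\<close> is a small perturbation of a multiple of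
  the identity; by induction one may take \<open>r\<^sub>0 = \<lambda>\<^sub>k / 2 - \<delta>\<close> and
  \<open>r\<^sub>t\<^sub>+\<^sub>1 = (\<lambda>\<^sub>k - \<delta>) - \<beta> / r\<^sub>t\<close>. Products of consecutive \<open>r\<^sub>t\<close> satisfy a linear
  recurrence with characteristic polynomial \<open>x\<^sup>2 - (\<lambda>\<^sub>k - \<delta>) x + \<beta>\<close>; comparing them with
  \<open>\<rho>\<^sup>n\<close> for a \<open>\<rho>\<close> between its roots gives the lower bound \<open>(15/31) \<rho>\<^sup>n\<close>.
  The bounds on \<open>p\<^sub>t\<close> and \<open>q\<^sub>t\<close> are checked on the diagonal entries
  \<open>x \<in> [0, 2 \<surd>\<beta>]\<close> of \<open>\<Lambda>\<^sub>-\<^sub>k\<close>, using the conserved quantity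
  \<open>p\<^sub>t\<^sub>+\<^sub>1\<^sup>2 - x p\<^sub>t\<^sub>+\<^sub>1 p\<^sub>t + \<beta> p\<^sub>t\<^sup>2 = \<beta>\<^sup>t (\<beta> - x\<^sup>2/4)\<close> and its analogue for \<open>q\<^sub>t\<close>.\<close>

lemma vnorm_eq_L2_set: "vnorm v = L2_set (\<lambda>i. v $ i) {0..<dim_vec v}"
  unfolding vnorm_def L2_set_def scalar_prod_def power2_eq_square by simp

lemma vnorm_nonneg [simp]: "vnorm v \<ge> 0"
  unfolding vnorm_eq_L2_set by (rule L2_set_nonneg)

lemma vnorm_square: "vnorm v ^ 2 = (\<Sum>i<dim_vec v. (v $ i)^2)"
  unfolding vnorm_eq_L2_set L2_set_def by (simp add: sum_nonneg atLeast0LessThan)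

lemma vnorm_square_eq_scalar_prod: "vnorm v ^ 2 = v \<bullet> v"
  unfolding vnorm_def by (simp add: scalar_prod_def sum_nonneg)

lemma vnorm_eq_0_iff: "vnorm v = 0 \<longleftrightarrow> v = 0\<^sub>v (dim_vec v)"
proof
  assume "vnorm v = 0"
  then have "(\<Sum>i<dim_vec v. (v $ i)^2) = 0" by (simp add: vnorm_square [symmetric])
  then have "\<forall>i<dim_vec v. (v $ i)^2 = 0" by (simp add: sum_nonneg_eq_0_iff)
  then show "v = 0\<^sub>v (dim_vec v)" by (intro eq_vecI) auto
next
  assume "v = 0\<^sub>v (dim_vec v)"
  then have "\<forall>i<dim_vec v. v $ i = 0" by (metis index_zero_vec(1))
  then show "vnorm v = 0" by (simp add: vnorm_def scalar_prod_def)
qed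

lemma vnorm_zero_vec [simp]: "vnorm (0\<^sub>v n) = 0"
  by (simp add: vnorm_eq_0_iff)

lemma mult_mat_vec_zero_vec [simp]: "M *\<^sub>v 0\<^sub>v (dim_col M) = 0\<^sub>v (dim_row M)"
  by (intro eq_vecI) auto

lemma vnorm_triangle:
  assumes "dim_vec v = dim_vec w"
  shows "vnorm (v + w) \<le> vnorm v + vnorm w"
proof -
  have "vnorm (v + w) = L2_set (\<lambda>i. v $ i + w $ i) {0..<dim_vec w}"
    unfolding vnorm_eq_L2_set by (rule L2_set_cong) auto
  also have "\<dots> \<le> vnorm v + vnorm w"
    unfolding vnorm_eq_L2_set using assms by (simp add: L2_set_triangle_ineq)
  finally show ?thesis .
qed

lemma vnorm_smult: "vnorm (a \<cdot>\<^sub>v v) = \<bar>a\<bar> * vnorm v"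
proof -
  have "vnorm (a \<cdot>\<^sub>v v) = L2_set (\<lambda>i. \<bar>a\<bar> * \<bar>v $ i\<bar>) {0..<dim_vec v}"
    unfolding vnorm_eq_L2_set L2_set_def
    by (intro arg_cong[where f = sqrt] sum.cong) (auto simp: power_mult_distrib)
  also have "\<dots> = \<bar>a\<bar> * L2_set (\<lambda>i. \<bar>v $ i\<bar>) {0..<dim_vec v}"
    by (simp add: L2_set_right_distrib)
  finally show ?thesis unfolding vnorm_eq_L2_set L2_set_def by simp
qed

lemma vnorm_add_ge:
  assumes "dim_vec v = dim_vec w"
  shows "vnorm v - vnorm w \<le> vnorm (v + w)"
proof -
  have "v = (v + w) + (-1) \<cdot>\<^sub>v w" using assms by (intro eq_vecI) auto
  then have "vnorm v \<le> vnorm (v + w) + vnorm ((-1) \<cdot>\<^sub>v w)"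
    using vnorm_triangle[of "v + w" "(-1) \<cdot>\<^sub>v w"] assms by simp
  then show ?thesis by (simp add: vnorm_smult)
qed

lemma vnorm_mult_mat_vec_le_Frobenius:
  assumes "x \<in> carrier_vec (dim_col M)"
  shows "vnorm (M *\<^sub>v x) \<le> sqrt (\<Sum>i<dim_row M. (vnorm (row M i))^2) * vnorm x"
proof -
  have "((M *\<^sub>v x) $ i)^2 \<le> (vnorm (row M i) * vnorm x)^2" if "i < dim_row M" for i
  proof -
    have "\<bar>(M *\<^sub>v x) $ i\<bar> \<le> (\<Sum>j\<in>{0..<dim_col M}. \<bar>row M i $ j\<bar> * \<bar>x $ j\<bar>)"
      using that assms by (auto simp: scalar_prod_def abs_mult intro: order_trans[OF sum_abs])
    also have "\<dots> \<le> vnorm (row M i) * vnorm x"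
      using assms unfolding vnorm_eq_L2_set by (auto intro: L2_set_mult_ineq)
    finally have "\<bar>(M *\<^sub>v x) $ i\<bar> \<le> vnorm (row M i) * vnorm x" .
    from power_mono[OF this abs_ge_zero, of 2] show ?thesis by simp
  qed
  then have "(\<Sum>i<dim_row M. ((M *\<^sub>v x) $ i)^2) \<le> (\<Sum>i<dim_row M. (vnorm (row M i))^2) * vnorm x ^ 2"
    by (auto simp: power_mult_distrib sum_distrib_right intro: sum_mono)
  then have "vnorm (M *\<^sub>v x) ^ 2 \<le> (sqrt (\<Sum>i<dim_row M. (vnorm (row M i))^2) * vnorm x) ^ 2"
    by (simp add: vnorm_square[of "M *\<^sub>v x"] power_mult_distrib sum_nonneg)
  then show ?thesis by (rule power2_le_imp_le) (simp add: sum_nonneg)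
qed

lemma spec_norm_set_bdd_above:
  "bdd_above {vnorm (M *\<^sub>v x) | x. x \<in> carrier_vec (dim_col M) \<and> vnorm x \<le> 1}"
proof (rule bdd_aboveI, clarify)
  let ?K = "sqrt (\<Sum>i<dim_row M. (vnorm (row M i))^2)"
  fix x :: "real vec" assume x: "x \<in> carrier_vec (dim_col M)" "vnorm x \<le> 1"
  have "vnorm (M *\<^sub>v x) \<le> ?K * vnorm x" by (rule vnorm_mult_mat_vec_le_Frobenius[OF x(1)])
  also have "\<dots> \<le> ?K" using x(2) by (simp add: mult_left_le sum_nonneg)
  finally show "vnorm (M *\<^sub>v x) \<le> ?K" .
qed

lemma vnorm_mult_mat_vec_le:
  assumes x: "x \<in> carrier_vec (dim_col M)"
  shows "vnorm (M *\<^sub>v x) \<le> spec_norm M * vnorm x"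
proof (cases "vnorm x = 0")
  case True
  then have "x = 0\<^sub>v (dim_col M)" using x by (simp add: vnorm_eq_0_iff)
  then show ?thesis using True by simp
next
  case False
  then have pos: "vnorm x > 0" using vnorm_nonneg[of x] by linarith
  have "M *\<^sub>v ((1 / vnorm x) \<cdot>\<^sub>v x) = (1 / vnorm x) \<cdot>\<^sub>v (M *\<^sub>v x)"
    by (rule mult_mat_vec[OF _ x]) auto
  moreover have "vnorm (M *\<^sub>v ((1 / vnorm x) \<cdot>\<^sub>v x)) \<le> spec_norm M"
    unfolding spec_norm_def using x pos
    by (intro cSup_upper[OF _ spec_norm_set_bdd_above]) (auto simp: vnorm_smult)
  ultimately show ?thesis using pos by (simp add: vnorm_smult field_simps)
qed

lemma spec_norm_nonneg: "spec_norm M \<ge> 0"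
proof -
  have "vnorm (M *\<^sub>v 0\<^sub>v (dim_col M)) \<le> spec_norm M"
    unfolding spec_norm_def
    by (rule cSup_upper[OF _ spec_norm_set_bdd_above], intro CollectI exI[of _ "0\<^sub>v (dim_col M)"]) simp
  then show ?thesis by simp
qed

lemma spec_norm_le:
  assumes "K \<ge> 0" and bound: "\<And>x. x \<in> carrier_vec (dim_col M) \<Longrightarrow> vnorm (M *\<^sub>v x) \<le> K * vnorm x"
  shows "spec_norm M \<le> K"
  unfolding spec_norm_def
proof (rule cSup_least)
  let ?S = "{vnorm (M *\<^sub>v x) |x. x \<in> carrier_vec (dim_col M) \<and> vnorm x \<le> 1}"
  have "vnorm (M *\<^sub>v 0\<^sub>v (dim_col M)) \<in> ?S" by (intro CollectI exI[of _ "0\<^sub>v (dim_col M)"]) simp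
  then show "?S \<noteq> {}" by blast
next
  fix y assume "y \<in> {vnorm (M *\<^sub>v x) |x. x \<in> carrier_vec (dim_col M) \<and> vnorm x \<le> 1}"
  then obtain x where x: "x \<in> carrier_vec (dim_col M)" "vnorm x \<le> 1" and y: "y = vnorm (M *\<^sub>v x)"
    by auto
  have "y \<le> K * vnorm x" using bound[OF x(1)] y by simp
  also have "\<dots> \<le> K" using assms(1) x(2) by (simp add: mult_left_le)
  finally show "y \<le> K" .
qed

lemma spec_norm_mult_le:
  assumes "A \<in> carrier_mat n m" and "B \<in> carrier_mat m p"
  shows "spec_norm (A * B) \<le> spec_norm A * spec_norm B"
proof (rule spec_norm_le)
  fix x :: "real vec" assume "x \<in> carrier_vec (dim_col (A * B))"
  then have x: "x \<in> carrier_vec p" using assms by simp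
  have "vnorm ((A * B) *\<^sub>v x) = vnorm (A *\<^sub>v (B *\<^sub>v x))" using assms x by simp
  also have "\<dots> \<le> spec_norm A * vnorm (B *\<^sub>v x)"
    using assms x by (intro vnorm_mult_mat_vec_le) simp
  also have "\<dots> \<le> spec_norm A * (spec_norm B * vnorm x)"
    using assms x by (intro mult_left_mono vnorm_mult_mat_vec_le spec_norm_nonneg) simp_all
  finally show "vnorm ((A * B) *\<^sub>v x) \<le> spec_norm A * spec_norm B * vnorm x" by (simp add: ac_simps)
qed (simp add: spec_norm_nonneg)

lemma spec_norm_mult3_le:
  assumes "A \<in> carrier_mat n m" and "B \<in> carrier_mat m p" and "C \<in> carrier_mat p q"
  shows "spec_norm (A * B * C) \<le> spec_norm A * spec_norm B * spec_norm C"
  using assms spec_norm_mult_le[of "A * B" n p C q] 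
  by (auto intro: order_trans mult_right_mono spec_norm_mult_le spec_norm_nonneg)

lemma spec_norm_add_le:
  assumes "A \<in> carrier_mat n m" and "B \<in> carrier_mat n m"
  shows "spec_norm (A + B) \<le> spec_norm A + spec_norm B"
proof (rule spec_norm_le)
  fix x :: "real vec" assume "x \<in> carrier_vec (dim_col (A + B))"
  then have x: "x \<in> carrier_vec m" using assms by simp
  have "vnorm ((A + B) *\<^sub>v x) \<le> vnorm (A *\<^sub>v x) + vnorm (B *\<^sub>v x)"
    using assms x by (simp add: add_mult_distrib_mat_vec vnorm_triangle)
  also have "\<dots> \<le> spec_norm A * vnorm x + spec_norm B * vnorm x"
    using assms x by (intro add_mono vnorm_mult_mat_vec_le) simp_all
  finally show "vnorm ((A + B) *\<^sub>v x) \<le> (spec_norm A + spec_norm B) * vnorm x"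
    by (simp add: algebra_simps)
qed (simp add: spec_norm_nonneg add_nonneg_nonneg)

lemma smult_mat_mult_vec:
  "x \<in> carrier_vec (dim_col A) \<Longrightarrow> (a \<cdot>\<^sub>m A) *\<^sub>v x = a \<cdot>\<^sub>v (A *\<^sub>v x)"
  by (intro eq_vecI) (auto simp: scalar_prod_def sum_distrib_left ac_simps)

lemma spec_norm_smult: "spec_norm (a \<cdot>\<^sub>m A) \<le> \<bar>a\<bar> * spec_norm A"
proof (rule spec_norm_le)
  fix x :: "real vec" assume "x \<in> carrier_vec (dim_col (a \<cdot>\<^sub>m A))"
  then have x: "x \<in> carrier_vec (dim_col A)" by simp
  then show "vnorm ((a \<cdot>\<^sub>m A) *\<^sub>v x) \<le> \<bar>a\<bar> * spec_norm A * vnorm x"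
    using vnorm_mult_mat_vec_le[OF x] by (simp add: smult_mat_mult_vec vnorm_smult mult.assoc mult_left_mono)
qed (simp add: spec_norm_nonneg)

lemma spec_norm_one_mat: "spec_norm (1\<^sub>m n) \<le> 1"
  by (rule spec_norm_le) auto

lemma spec_norm_zero_mat: "spec_norm (0\<^sub>m n m) = 0"
proof -
  have "0\<^sub>m n m *\<^sub>v x = 0\<^sub>v n" if "x \<in> carrier_vec m" for x :: "real vec"
    using that by (intro eq_vecI) auto
  then have "spec_norm (0\<^sub>m n m) \<le> 0" by (intro spec_norm_le) auto
  then show ?thesis using spec_norm_nonneg[of "0\<^sub>m n m"] by simp
qed

lemma minv_carrier: "minv M \<in> carrier_mat (dim_row M) (dim_row M)"
  unfolding minv_def by (auto intro: someI2_ex)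

lemma minv_carrier_mat: "A \<in> carrier_mat n m \<Longrightarrow> minv A \<in> carrier_mat n n"
  using minv_carrier[of A] by simp

lemma minv_eqI:
  assumes A: "A \<in> carrier_mat n n" and B: "B \<in> carrier_mat n n" and AB: "A * B = 1\<^sub>m n"
  shows "minv A = B"
proof -
  have BA: "B * A = 1\<^sub>m n" by (rule mat_mult_left_right_inverse[OF A B AB])
  let ?P = "\<lambda>N. N \<in> carrier_mat (dim_row A) (dim_row A) \<and> inverts_mat A N \<and> inverts_mat N A"
  have ex: "\<exists>N. ?P N" using A B AB BA by (intro exI[of _ B]) (auto simp: inverts_mat_def)
  have "?P (SOME N. ?P N)" by (rule someI_ex[OF ex])
  then have N: "(SOME N. ?P N) \<in> carrier_mat n n" "(SOME N. ?P N) * A = 1\<^sub>m n"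
    using A unfolding inverts_mat_def by auto
  have "minv A = (SOME N. ?P N)" unfolding minv_def using ex by simp
  also have "\<dots> = (SOME N. ?P N) * (A * B)" using N AB by simp
  also have "\<dots> = B" using N A B by (simp flip: assoc_mult_mat)
  finally show ?thesis .
qed

lemma invertible_matI:
  fixes A B :: "real mat"
  assumes "A \<in> carrier_mat n n" and "B \<in> carrier_mat n n" and "A * B = 1\<^sub>m n"
  shows "invertible_mat A"
  using assms mat_mult_left_right_inverse[OF assms]
  unfolding invertible_mat_def inverts_mat_def by auto

lemma invertible_mat_minv:
  assumes A: "A \<in> carrier_mat n n" and "invertible_mat A"
  shows "A * minv A = 1\<^sub>m n" and "minv A * A = 1\<^sub>m n"
proof -
  obtain B where "A * B = 1\<^sub>m n" "B * A = 1\<^sub>m (dim_row B)"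
    using assms unfolding invertible_mat_def inverts_mat_def by auto
  moreover from this have "B \<in> carrier_mat n n"
    using A by (metis carrier_matD index_mult_mat(2,3) index_one_mat(2,3) carrier_matI)
  ultimately have "minv A = B" "B * A = 1\<^sub>m n" using minv_eqI[OF A] by auto
  then show "A * minv A = 1\<^sub>m n" "minv A * A = 1\<^sub>m n" using \<open>A * B = 1\<^sub>m n\<close> by auto
qed

lemma minv_not_invertible:
  assumes "A \<in> carrier_mat n n" and "\<not> invertible_mat A"
  shows "minv A = 0\<^sub>m n n"
  using assms unfolding minv_def invertible_mat_def by auto

lemma minv_minv:
  assumes A: "A \<in> carrier_mat n n" and "invertible_mat A"
  shows "invertible_mat (minv A)" and "minv (minv A) = A"
proof -
  have Ai: "minv A \<in> carrier_mat n n" using minv_carrier[of A] A by simp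
  show "invertible_mat (minv A)" "minv (minv A) = A"
    using invertible_mat_minv[OF assms] invertible_matI[OF Ai A] minv_eqI[OF Ai A] by auto
qed

lemma minv_mult:
  assumes A: "A \<in> carrier_mat n n" "invertible_mat A" and B: "B \<in> carrier_mat n n" "invertible_mat B"
  shows "invertible_mat (A * B)" and "minv (A * B) = minv B * minv A"
proof -
  have Ai: "minv A \<in> carrier_mat n n" and Bi: "minv B \<in> carrier_mat n n"
    using minv_carrier A(1) B(1) by auto
  have "(A * B) * (minv B * minv A) = A * (B * minv B) * minv A"
    using A B Ai Bi by (simp add: assoc_mult_mat[of _ n n _ n _ n])
  also have "\<dots> = 1\<^sub>m n" using invertible_mat_minv[OF A] invertible_mat_minv[OF B] A Ai by simp
  finally have inv: "(A * B) * (minv B * minv A) = 1\<^sub>m n" .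
  show "invertible_mat (A * B)" "minv (A * B) = minv B * minv A"
    using invertible_matI[OF _ _ inv] minv_eqI[OF _ _ inv] A B Ai Bi by auto
qed

lemma spec_norm_minv_le:
  assumes M: "M \<in> carrier_mat n n" "invertible_mat M" and "\<mu> > 0"
    and below: "\<And>x. x \<in> carrier_vec n \<Longrightarrow> \<mu> * vnorm x \<le> vnorm (M *\<^sub>v x)"
  shows "spec_norm (minv M) \<le> 1 / \<mu>"
proof (rule spec_norm_le)
  fix y :: "real vec" assume "y \<in> carrier_vec (dim_col (minv M))"
  then have y: "y \<in> carrier_vec n" using minv_carrier[of M] M by simp
  have "M *\<^sub>v (minv M *\<^sub>v y) = y"
    using invertible_mat_minv[OF M] minv_carrier[of M] M y by (simp flip: assoc_mult_mat_vec)
  then have "\<mu> * vnorm (minv M *\<^sub>v y) \<le> vnorm y"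
    using below[of "minv M *\<^sub>v y"] minv_carrier[of M] M y by simp
  then show "vnorm (minv M *\<^sub>v y) \<le> 1 / \<mu> * vnorm y" using \<open>\<mu> > 0\<close> by (simp add: field_simps)
qed (use \<open>\<mu> > 0\<close> in simp)

lemma invertible_if_bounded_below:
  assumes M: "M \<in> carrier_mat n n" and "\<mu> > 0"
    and below: "\<And>x. x \<in> carrier_vec n \<Longrightarrow> \<mu> * vnorm x \<le> vnorm (M *\<^sub>v x)"
  shows "invertible_mat M" and "spec_norm (minv M) \<le> 1 / \<mu>"
proof -
  have "det M \<noteq> 0"
  proof
    assume "det M = 0"
    then obtain v where v: "v \<in> carrier_vec n" "v \<noteq> 0\<^sub>v n" "M *\<^sub>v v = 0\<^sub>v n"
      using det_0_iff_vec_prod_zero[OF M] by auto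
    then have "vnorm v = 0" using below[OF v(1)] \<open>\<mu> > 0\<close> vnorm_nonneg[of v]
      by (simp add: mult_le_0_iff)
    then show False using v by (simp add: vnorm_eq_0_iff)
  qed
  then obtain N where "N \<in> carrier_mat n n" "M * N = 1\<^sub>m n"
    using det_non_zero_imp_unit[OF M, of "()"] unfolding Units_def ring_mat_simps by auto
  then show "invertible_mat M" using invertible_matI[OF M] by blast
  then show "spec_norm (minv M) \<le> 1 / \<mu>" using spec_norm_minv_le[OF M _ \<open>\<mu> > 0\<close> below] by blast
qed

lemma invertible_scaled_one_plus:
  assumes P: "P \<in> carrier_mat n n" and "spec_norm P \<le> p" and "p < \<alpha>"
  shows "invertible_mat (\<alpha> \<cdot>\<^sub>m 1\<^sub>m n + P)" and "spec_norm (minv (\<alpha> \<cdot>\<^sub>m 1\<^sub>m n + P)) \<le> 1 / (\<alpha> - p)"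
proof -
  have "(\<alpha> - p) * vnorm x \<le> vnorm ((\<alpha> \<cdot>\<^sub>m 1\<^sub>m n + P) *\<^sub>v x)" if x: "x \<in> carrier_vec n" for x
  proof -
    have "(\<alpha> \<cdot>\<^sub>m 1\<^sub>m n + P) *\<^sub>v x = \<alpha> \<cdot>\<^sub>v x + P *\<^sub>v x"
      using P x by (simp add: add_mult_distrib_mat_vec[of _ n n] smult_mat_mult_vec)
    moreover have "vnorm (P *\<^sub>v x) \<le> spec_norm P * vnorm x"
      using P x by (intro vnorm_mult_mat_vec_le) simp
    moreover have "spec_norm P * vnorm x \<le> p * vnorm x"
      using \<open>spec_norm P \<le> p\<close> by (simp add: mult_right_mono)
    moreover have "vnorm (\<alpha> \<cdot>\<^sub>v x) - vnorm (P *\<^sub>v x) \<le> vnorm (\<alpha> \<cdot>\<^sub>v x + P *\<^sub>v x)"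
      using P x by (intro vnorm_add_ge) simp
    moreover have "\<alpha> > 0" using \<open>p < \<alpha>\<close> \<open>spec_norm P \<le> p\<close> spec_norm_nonneg[of P] by linarith
    ultimately show ?thesis by (simp add: vnorm_smult left_diff_distrib)
  qed
  then show "invertible_mat (\<alpha> \<cdot>\<^sub>m 1\<^sub>m n + P)" "spec_norm (minv (\<alpha> \<cdot>\<^sub>m 1\<^sub>m n + P)) \<le> 1 / (\<alpha> - p)"
    using invertible_if_bounded_below[of _ n "\<alpha> - p"] P \<open>p < \<alpha>\<close> by auto
qed

lemma sigma_min_nonneg:
  assumes "W \<in> carrier_mat n n" and "n \<ge> 1"
  shows "sigma_min W \<ge> 0"
proof -
  have "unit_vec n 0 \<in> carrier_vec n" "vnorm (unit_vec n 0) = 1"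
    using assms by (auto simp: vnorm_def)
  then have "{vnorm (W *\<^sub>v x) | x. x \<in> carrier_vec (dim_col W) \<and> vnorm x = 1} \<noteq> {}"
    using assms by blast
  then show ?thesis unfolding sigma_min_def by (rule cInf_greatest) auto
qed

lemma sigma_min_mult_vnorm_le:
  assumes x: "x \<in> carrier_vec (dim_col W)"
  shows "sigma_min W * vnorm x \<le> vnorm (W *\<^sub>v x)"
proof (cases "vnorm x = 0")
  case False
  then have pos: "vnorm x > 0" using vnorm_nonneg[of x] by linarith
  have "W *\<^sub>v ((1 / vnorm x) \<cdot>\<^sub>v x) = (1 / vnorm x) \<cdot>\<^sub>v (W *\<^sub>v x)"
    by (rule mult_mat_vec[OF _ x]) auto
  moreover have "sigma_min W \<le> vnorm (W *\<^sub>v ((1 / vnorm x) \<cdot>\<^sub>v x))"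
    unfolding sigma_min_def using x pos
    by (intro cInf_lower[OF _ bdd_belowI[of _ 0]]) (auto simp: vnorm_smult)
  ultimately show ?thesis using pos by (simp add: vnorm_smult field_simps)
qed simp

text \<open>This also holds for singular \<open>W\<close>, where \<open>minv W\<close> is the zero matrix.\<close>

lemma sigma_min_mult_spec_norm_minv_le:
  assumes W: "W \<in> carrier_mat n n" and "n \<ge> 1"
  shows "sigma_min W * spec_norm (minv W) \<le> 1"
proof (cases "invertible_mat W \<and> sigma_min W > 0")
  case True
  then have "spec_norm (minv W) \<le> 1 / sigma_min W"
    using W sigma_min_mult_vnorm_le[of _ W] by (intro spec_norm_minv_le) auto
  then show ?thesis using True by (simp add: field_simps)
next
  case False
  then show ?thesis
    using sigma_min_nonneg[OF assms] minv_not_invertible[OF W] by (auto simp: spec_norm_zero_mat)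
qed

lemma dim_mat_diag [simp]: "dim_row (mat_diag n f) = n" "dim_col (mat_diag n f) = n"
  unfolding mat_diag_def by simp_all

lemma mat_diag_smult: "(a :: real) \<cdot>\<^sub>m mat_diag n f = mat_diag n (\<lambda>i. a * f i)"
  unfolding mat_diag_def by (rule eq_matI) auto

lemma mat_diag_minus: "mat_diag n f - mat_diag n g = mat_diag n (\<lambda>i. f i - g i :: real)"
  unfolding mat_diag_def by (rule eq_matI) auto

lemma mat_diag_mult_vec_index:
  fixes f :: "nat \<Rightarrow> real"
  assumes "x \<in> carrier_vec n" and "i < n"
  shows "(mat_diag n f *\<^sub>v x) $ i = f i * x $ i"
proof -
  have "(\<Sum>j = 0..<n. (if i = j then f j else 0) * x $ j) = (\<Sum>j = 0..<n. if j = i then f i * x $ i else 0)"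
    by (rule sum.cong) auto
  then show ?thesis using assms by (simp add: mat_diag_def scalar_prod_def)
qed

lemma spec_norm_mat_diag_le:
  assumes "b \<ge> 0" and f: "\<And>i. i < n \<Longrightarrow> \<bar>f i\<bar> \<le> b"
  shows "spec_norm (mat_diag n f :: real mat) \<le> b"
proof (rule spec_norm_le[OF \<open>b \<ge> 0\<close>])
  fix x :: "real vec" assume "x \<in> carrier_vec (dim_col (mat_diag n f))"
  then have x: "x \<in> carrier_vec n" by simp
  have "((mat_diag n f *\<^sub>v x) $ i)^2 \<le> b^2 * (x $ i)^2" if "i < n" for i
    using mat_diag_mult_vec_index[OF x that] power_mono[OF f[OF that] abs_ge_zero, of 2]
    by (simp add: power_mult_distrib mult_right_mono)
  then have "(\<Sum>i<n. ((mat_diag n f *\<^sub>v x) $ i)^2) \<le> (\<Sum>i<n. b^2 * (x $ i)^2)"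
    by (intro sum_mono) simp
  moreover have "dim_vec (mat_diag n f *\<^sub>v x) = n" by simp
  ultimately have "vnorm (mat_diag n f *\<^sub>v x) ^ 2 \<le> (b * vnorm x)^2"
    using x by (simp only: vnorm_square power_mult_distrib sum_distrib_left carrier_vecD)
  then show "vnorm (mat_diag n f *\<^sub>v x) \<le> b * vnorm x"
    by (rule power2_le_imp_le) (use \<open>b \<ge> 0\<close> in simp)
qed

fun p_poly :: "real \<Rightarrow> real \<Rightarrow> nat \<Rightarrow> real" where
  "p_poly b x 0 = 1"
| "p_poly b x (Suc 0) = x / 2"
| "p_poly b x (Suc (Suc t)) = x * p_poly b x (Suc t) - b * p_poly b x t"

fun q_poly :: "real \<Rightarrow> real \<Rightarrow> nat \<Rightarrow> real" where
  "q_poly b x 0 = 1"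
| "q_poly b x (Suc 0) = x"
| "q_poly b x (Suc (Suc t)) = x * q_poly b x (Suc t) - b * q_poly b x t"

lemma pmat_mat_diag: "pmat b (mat_diag n f) t = mat_diag n (\<lambda>i. p_poly b (f i) t)"
  by (induction t rule: p_poly.induct[where P = "\<lambda>_ _ t. pmat b (mat_diag n f) t = mat_diag n (\<lambda>i. p_poly b (f i) t)"])
    (simp_all add: mat_diag_smult mat_diag_minus flip: mat_diag_one)

lemma qmat_mat_diag: "qmat b (mat_diag n f) t = mat_diag n (\<lambda>i. q_poly b (f i) t)"
  by (induction t rule: q_poly.induct[where P = "\<lambda>_ _ t. qmat b (mat_diag n f) t = mat_diag n (\<lambda>i. q_poly b (f i) t)"])
    (simp_all add: mat_diag_smult mat_diag_minus flip: mat_diag_one)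

lemma p_poly_invariant:
  "p_poly b x (Suc t) ^ 2 - x * p_poly b x (Suc t) * p_poly b x t + b * p_poly b x t ^ 2 = b ^ t * (b - x^2/4)"
proof (induction t)
  case (Suc t)
  let ?f = "p_poly b x"
  have "?f (Suc (Suc t)) ^ 2 - x * ?f (Suc (Suc t)) * ?f (Suc t) + b * ?f (Suc t) ^ 2
      = b * (?f (Suc t) ^ 2 - x * ?f (Suc t) * ?f t + b * ?f t ^ 2)"
    by (simp add: power2_eq_square algebra_simps)
  then show ?case using Suc by simp
qed (simp add: power2_eq_square field_simps)

lemma q_poly_invariant:
  "q_poly b x (Suc t) ^ 2 - x * q_poly b x (Suc t) * q_poly b x t + b * q_poly b x t ^ 2 = b ^ Suc t"
proof (induction t)
  case (Suc t)
  let ?f = "q_poly b x"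
  have "?f (Suc (Suc t)) ^ 2 - x * ?f (Suc (Suc t)) * ?f (Suc t) + b * ?f (Suc t) ^ 2
      = b * (?f (Suc t) ^ 2 - x * ?f (Suc t) * ?f t + b * ?f t ^ 2)"
    by (simp add: power2_eq_square algebra_simps)
  then show ?case using Suc by simp
qed (simp add: power2_eq_square field_simps)

lemma p_poly_at_double: "p_poly (s^2) (2 * s) t = s ^ t"
  by (induction "s^2" "2 * s" t rule: p_poly.induct) (auto simp: power2_eq_square algebra_simps)

lemma abs_p_poly_le:
  assumes "s > 0" and "0 \<le> x" and "x \<le> 2 * s"
  shows "\<bar>p_poly (s^2) x t\<bar> \<le> s ^ t"
proof (cases "x = 2 * s")
  case True
  then show ?thesis using \<open>s > 0\<close> by (simp add: p_poly_at_double)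
next
  case False
  then have "x^2 < (2 * s)^2" using assms by (intro power_strict_mono) auto
  then have gap: "4 * s^2 - x^2 > 0" by (simp add: power_mult_distrib)
  show ?thesis
  proof (cases t)
    case (Suc t')
    define a b where "a = p_poly (s^2) x (Suc t')" and "b = p_poly (s^2) x t'"
    have inv: "a^2 - x * a * b + s^2 * b^2 = (s^2)^t' * (s^2 - x^2/4)"
      unfolding a_def b_def by (rule p_poly_invariant)
    have "(2 * s^2 * b - x * a)^2 + (4 * s^2 - x^2) * a^2 = 4 * s^2 * (a^2 - x * a * b + s^2 * b^2)"
      by (simp add: power2_eq_square algebra_simps)
    also have "\<dots> = (4 * s^2 - x^2) * (s ^ Suc t')^2" unfolding inv
      by (simp add: power2_eq_square power_mult_distrib algebra_simps flip: power_mult)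
    finally have "(4 * s^2 - x^2) * a^2 \<le> (4 * s^2 - x^2) * (s ^ Suc t')^2"
      using zero_le_power2[of "2 * s^2 * b - x * a"] by linarith
    then have "a^2 \<le> (s ^ Suc t')^2" using gap by simp
    then have "\<bar>a\<bar> \<le> s ^ Suc t'" using \<open>s > 0\<close> by (simp add: power2_le_iff_abs_le)
    then show ?thesis using Suc unfolding a_def by simp
  qed simp
qed

lemma abs_q_poly_le:
  assumes "s > 0" and "0 \<le> x" and "x \<le> 2 * s"
  shows "\<bar>q_poly (s^2) x t\<bar> \<le> real (t + 1) * s ^ t"
proof (induction t)
  case (Suc t)
  define a b where "a = q_poly (s^2) x (Suc t)" and "b = q_poly (s^2) x t"
  have "x^2 \<le> (2 * s)^2" using assms by (intro power_mono) auto
  then have "(4 * s^2 - x^2) * b^2 \<ge> 0" by (simp add: power_mult_distrib)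
  moreover have inv: "a^2 - x * a * b + s^2 * b^2 = (s^2) ^ Suc t"
    unfolding a_def b_def by (rule q_poly_invariant)
  have "(2 * a - x * b)^2 + (4 * s^2 - x^2) * b^2 = 4 * (a^2 - x * a * b + s^2 * b^2)"
    by (simp add: power2_eq_square algebra_simps)
  also have "\<dots> = (2 * s ^ Suc t)^2" unfolding inv
    by (simp add: power_mult_distrib flip: power_mult) (simp add: mult.commute)
  ultimately have "(2 * a - x * b)^2 \<le> (2 * s ^ Suc t)^2" by linarith
  then have "\<bar>2 * a - x * b\<bar> \<le> 2 * s ^ Suc t"
    using power2_le_iff_abs_le[of "2 * s ^ Suc t" "2 * a - x * b"] \<open>s > 0\<close> by simp
  moreover have "x * \<bar>b\<bar> \<le> 2 * s * (real (t + 1) * s ^ t)"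
    using assms Suc unfolding b_def by (intro mult_mono) auto
  moreover have "\<bar>x * b\<bar> = x * \<bar>b\<bar>" using assms by (simp add: abs_mult)
  ultimately have "2 * \<bar>a\<bar> \<le> 2 * s ^ Suc t + 2 * s * (real (t + 1) * s ^ t)" by linarith
  then show ?case unfolding a_def by (simp add: algebra_simps)
qed simp

lemma spec_norm_pmat_mat_diag_le:
  assumes "\<beta> > 0" and "\<And>i. i < n \<Longrightarrow> 0 \<le> f i \<and> f i \<le> 2 * sqrt \<beta>"
  shows "spec_norm (pmat \<beta> (mat_diag n f) t) \<le> sqrt \<beta> ^ t"
  using assms abs_p_poly_le[of "sqrt \<beta>"] unfolding pmat_mat_diag
  by (intro spec_norm_mat_diag_le) auto

lemma spec_norm_qmat_mat_diag_le:
  assumes "\<beta> > 0" and "\<And>i. i < n \<Longrightarrow> 0 \<le> f i \<and> f i \<le> 2 * sqrt \<beta>"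
  shows "spec_norm (qmat \<beta> (mat_diag n f) t) \<le> real (t + 1) * sqrt \<beta> ^ t"
  using assms abs_q_poly_le[of "sqrt \<beta>"] unfolding qmat_mat_diag
  by (intro spec_norm_mat_diag_le) auto

text \<open>The partial products of \<open>riccati_seq\<close> satisfy the linear recurrence
  \<open>S\<^sub>n\<^sub>+\<^sub>2 = a S\<^sub>n\<^sub>+\<^sub>1 - b S\<^sub>n\<close>, which is how they are bounded below.\<close>

fun riccati_seq :: "real \<Rightarrow> real \<Rightarrow> real \<Rightarrow> nat \<Rightarrow> real" where
  "riccati_seq a b r 0 = r"
| "riccati_seq a b r (Suc n) = a - b / riccati_seq a b r n"

lemma riccati_seq_ge:
  assumes "r > 0" and "b \<ge> 0" and "r^2 - a * r + b \<le> 0"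
  shows "riccati_seq a b r n \<ge> r"
proof (induction n)
  case (Suc n)
  have "b / riccati_seq a b r n \<le> b / r"
    using Suc assms by (intro divide_left_mono) auto
  moreover have "a - b / r \<ge> r" using assms by (simp add: field_simps power2_eq_square)
  ultimately show ?case by simp
qed simp

lemma linear_recurrence_lower_bound:
  fixes S :: "nat \<Rightarrow> real"
  assumes S0: "S 0 = 1" and rec: "\<And>n. S (n + 2) = a * S (n + 1) - b * S n"
    and x: "0 \<le> x" "x \<le> a" "x * (a - x) = b"
    and \<rho>: "\<rho> \<ge> 0" "\<rho>^2 - a * \<rho> + b \<le> 0"
    and \<kappa>: "0 \<le> \<kappa>" "\<kappa> \<le> 1" and S1: "S 1 - \<kappa> * \<rho> \<ge> (1 - \<kappa>) * x"
  shows "S n \<ge> \<kappa> * \<rho> ^ n"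
proof -
  define Q where "Q n = S n - \<kappa> * \<rho> ^ n" for n
  define D where "D n = Q (n + 1) - x * Q n" for n
  \<comment> \<open>\<open>x\<close> and \<open>a - x\<close> are the characteristic roots, so \<open>D\<close> grows at least like \<open>(a - x)\<^sup>n\<close>
    as long as \<open>\<rho>\<close> lies between them.\<close>
  have "D (Suc n) - (a - x) * D n = - \<kappa> * \<rho> ^ n * (\<rho>^2 - a * \<rho> + b)" for n
    using rec[of n, unfolded x(3)[symmetric]] unfolding D_def Q_def x(3)[symmetric]
    by (simp add: algebra_simps power2_eq_square)
  moreover have "\<kappa> * \<rho> ^ n * (\<rho>^2 - a * \<rho> + b) \<le> 0" for n
    using \<rho> \<kappa> by (simp add: mult_nonneg_nonpos)
  ultimately have D_step: "D (Suc n) \<ge> (a - x) * D n" for n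
    by (metis diff_ge_0_iff_ge mult_minus_left neg_0_le_iff_le)
  have D: "D n \<ge> 0" for n
  proof (induction n)
    case 0
    then show ?case using S0 S1 unfolding D_def Q_def by (simp add: algebra_simps)
  next
    case (Suc n)
    then show ?case using D_step[of n] mult_nonneg_nonneg[of "a - x" "D n"] x by linarith
  qed
  have "Q n \<ge> 0" for n
  proof (induction n)
    case 0
    then show ?case using S0 \<kappa> unfolding Q_def by simp
  next
    case (Suc n)
    have "Q (Suc n) = D n + x * Q n" unfolding D_def by simp
    then show ?case using D[of n] mult_nonneg_nonneg[OF x(1) Suc] by linarith
  qed
  then show ?thesis unfolding Q_def by (simp add: algebra_simps)
qed

lemma prod_riccati_seq_ge:
  assumes r: "r > 0" "r^2 - a * r + b \<le> 0" and "b \<ge> 0"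
    and x: "0 \<le> x" "x \<le> a" "x * (a - x) = b"
    and \<rho>: "\<rho> \<ge> 0" "\<rho>^2 - a * \<rho> + b \<le> 0"
    and \<kappa>: "0 \<le> \<kappa>" "\<kappa> \<le> 1" "r - \<kappa> * \<rho> \<ge> (1 - \<kappa>) * x"
  shows "(\<Prod>i\<in>{m..<m+n}. riccati_seq a b r i) \<ge> \<kappa> * \<rho> ^ n"
proof -
  define S where "S n = (\<Prod>i\<in>{m..<m+n}. riccati_seq a b r i)" for n
  have S_Suc: "S (Suc n) = S n * riccati_seq a b r (m + n)" for n
    unfolding S_def by simp
  have pos: "riccati_seq a b r i > 0" for i
    using riccati_seq_ge[OF r(1) \<open>b \<ge> 0\<close> r(2)] r(1) by (meson less_le_trans)
  have "S (n + 2) = a * S (n + 1) - b * S n" for n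
  proof -
    have "S (n + 2) = S n * riccati_seq a b r (m + n) * riccati_seq a b r (Suc (m + n))"
      using S_Suc[of "Suc n"] S_Suc[of n] by simp
    also have "\<dots> = a * (S n * riccati_seq a b r (m + n)) - b * S n"
      using pos[of "m + n"] by (simp add: field_simps)
    finally show ?thesis using S_Suc[of n] by simp
  qed
  moreover have "S 1 - \<kappa> * \<rho> \<ge> (1 - \<kappa>) * x"
    using riccati_seq_ge[OF r(1) \<open>b \<ge> 0\<close> r(2), of m] \<kappa>(3) unfolding S_def by simp
  ultimately have "S n \<ge> \<kappa> * \<rho> ^ n"
    by (intro linear_recurrence_lower_bound[OF _ _ x \<rho> \<kappa>(1,2)]) (simp_all add: S_def)
  then show ?thesis unfolding S_def .
qed

lemma larger_root_parametrization:
  fixes l s :: real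
  assumes "s > 0" and "l > 2 * s"
  defines "p \<equiv> (l + sqrt (l^2 - 4 * s^2)) / 2"
  shows "p > s" and "l = (p^2 + s^2) / p"
proof -
  have "l^2 > (2 * s)^2" using assms(1,2) by (intro power_strict_mono) auto
  then have D: "sqrt (l^2 - 4 * s^2) ^ 2 = l^2 - 4 * s^2" "sqrt (l^2 - 4 * s^2) \<ge> 0"
    by (simp_all add: power_mult_distrib)
  from add_less_le_mono[OF assms(2) D(2)] have "p > s" unfolding p_def by simp
  moreover have "p^2 - l * p + s^2 = 0" using D(1) unfolding p_def by (simp add: power2_eq_square field_simps)
  ultimately show "p > s" and "l = (p^2 + s^2) / p"
    using \<open>s > 0\<close> by (simp_all add: field_simps power2_eq_square)
qed

text \<open>Writing \<open>l = (p\<^sup>2 + s\<^sup>2) / p\<close> with \<open>p\<close> the larger root of \<open>x\<^sup>2 - l x + s\<^sup>2\<close>, the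
  inequalities involving \<open>\<rho>\<close> below become signs of explicit rational functions of \<open>p > s > 0\<close>.\<close>

lemma anpm_rate_constants:
  fixes l s :: real
  assumes "s > 0" and "l > 2 * s"
  defines "\<delta> \<equiv> (l - 2 * s) / 32"
    and "\<rho> \<equiv> (1 - 1/32) * ((l + sqrt (l^2 - 4 * s^2)) / 2) + 1/32 * s"
  shows "l / 2 - \<delta> > 0" and "(l / 2 - \<delta>)^2 - (l - \<delta>) * (l / 2 - \<delta>) + s^2 \<le> 0"
    and "\<rho> > 0" and "\<rho>^2 - (l - \<delta>) * \<rho> + s^2 \<le> 0"
proof -
  define p where "p = (l + sqrt (l^2 - 4 * s^2)) / 2"
  note p = larger_root_parametrization[OF assms(1,2), folded p_def]
  have \<rho>_p: "\<rho> = (1 - 1/32) * p + 1/32 * s" unfolding \<rho>_def p_def ..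
  show "l / 2 - \<delta> > 0" using assms(1,2) unfolding \<delta>_def by simp
  show "\<rho> > 0" unfolding \<rho>_p using p(1) \<open>s > 0\<close> by simp
  have "(l / 2 - \<delta>)^2 - (l - \<delta>) * (l / 2 - \<delta>) + s^2 = s^2 - (15 * l^2 + 2 * s * l) / 64"
    unfolding \<delta>_def by (simp add: power2_eq_square field_simps)
  moreover have "l^2 > (2 * s)^2" using assms(1,2) by (intro power_strict_mono) auto
  moreover have "s * l > s * (2 * s)" using assms(1,2) by simp
  ultimately show "(l / 2 - \<delta>)^2 - (l - \<delta>) * (l / 2 - \<delta>) + s^2 \<le> 0"
    by (simp add: power2_eq_square)
  have "\<rho>^2 - (l - \<delta>) * \<rho> + s^2 = - 31 * s * (p - s)^2 / (1024 * p)"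
    unfolding \<rho>_p \<delta>_def p(2) using p(1) \<open>s > 0\<close> by (simp add: field_simps power2_eq_square)
  then show "\<rho>^2 - (l - \<delta>) * \<rho> + s^2 \<le> 0" using p(1) \<open>s > 0\<close> by (simp add: divide_nonpos_pos)
qed

lemma anpm_rate_smaller_root:
  fixes l s :: real
  assumes "s > 0" and "l > 2 * s"
  defines "\<delta> \<equiv> (l - 2 * s) / 32"
    and "\<rho> \<equiv> (1 - 1/32) * ((l + sqrt (l^2 - 4 * s^2)) / 2) + 1/32 * s"
  obtains x where "0 \<le> x" "x \<le> l - \<delta>" "x * (l - \<delta> - x) = s^2"
    and "(l / 2 - \<delta>) - 15/31 * \<rho> \<ge> (1 - 15/31) * x"
proof -
  define a r E where "a = l - \<delta>" and "r = l / 2 - \<delta>" and "E = sqrt ((l - \<delta>)^2 - 4 * s^2)"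
  define p where "p = (l + sqrt (l^2 - 4 * s^2)) / 2"
  note p = larger_root_parametrization[OF assms(1,2), folded p_def]
  have \<rho>_p: "\<rho> = (1 - 1/32) * p + 1/32 * s" unfolding \<rho>_def p_def ..
  have "a > 2 * s" unfolding a_def \<delta>_def using assms(1,2) by (simp add: field_simps)
  then have "a^2 > (2 * s)^2" using \<open>s > 0\<close> by (intro power_strict_mono) auto
  then have E: "E \<ge> 0" "E^2 = a^2 - 4 * s^2"
    unfolding E_def a_def by (auto simp: power_mult_distrib)
  have "E^2 \<le> a^2" "0 \<le> a" using E \<open>a > 2 * s\<close> \<open>s > 0\<close> by simp_all
  then have "E \<le> a" by (rule power2_le_imp_le)
  have "E \<ge> a - (31 * r - 15 * \<rho>) / 8"
  proof (cases "a - (31 * r - 15 * \<rho>) / 8 \<le> 0")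
    case False
    have "a^2 - 4 * s^2 - (a - (31 * r - 15 * \<rho>) / 8)^2
        = s * (p - s)^2 * (93248 * p + 57660 * s) / (512^2 * p^2)"
      unfolding \<rho>_p a_def r_def \<delta>_def p(2) using p(1) \<open>s > 0\<close> by (simp add: field_simps power2_eq_square)
    moreover have "s * (p - s)^2 * (93248 * p + 57660 * s) / (512^2 * p^2) \<ge> 0"
      using p(1) \<open>s > 0\<close> by simp
    ultimately have "(a - (31 * r - 15 * \<rho>) / 8)^2 \<le> E^2" using E by simp
    then show ?thesis using E(1) by (rule power2_le_imp_le)
  qed (use E in \<open>simp add: field_simps\<close>)
  then have "(l / 2 - \<delta>) - 15/31 * \<rho> \<ge> (1 - 15/31) * ((a - E) / 2)"
    unfolding r_def by (simp add: field_simps)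
  moreover have "(a - E) / 2 * (l - \<delta> - (a - E) / 2) = s^2"
    unfolding a_def[symmetric] using E(2) by (simp add: field_simps power2_eq_square)
  moreover have "0 \<le> (a - E) / 2" "(a - E) / 2 \<le> l - \<delta>"
    using E \<open>E \<le> a\<close> \<open>a > 2 * s\<close> \<open>s > 0\<close> unfolding a_def by auto
  ultimately show ?thesis by (intro that)
qed

lemma vnorm_orthonormal_mult:
  assumes X: "X \<in> carrier_mat d k" and "X\<^sup>T * X = 1\<^sub>m k" and x: "x \<in> carrier_vec k"
  shows "vnorm (X *\<^sub>v x) = vnorm x"
proof -
  have "(X *\<^sub>v x) \<bullet> (X *\<^sub>v x) = (X\<^sup>T *\<^sub>v (X *\<^sub>v x)) \<bullet> x"
    using X x by (intro transpose_vec_mult_scalar[symmetric]) auto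
  also have "X\<^sup>T *\<^sub>v (X *\<^sub>v x) = x"
    using assms by (simp flip: assoc_mult_mat_vec[of "X\<^sup>T" k d X k x])
  finally have "vnorm (X *\<^sub>v x) ^ 2 = vnorm x ^ 2" by (simp add: vnorm_square_eq_scalar_prod)
  then show ?thesis by (simp add: power2_eq_iff_nonneg)
qed

lemma vnorm_Ufirst_transpose_mult_le:
  assumes U: "U \<in> carrier_mat d d" "U\<^sup>T * U = 1\<^sub>m d" and "k \<le> d" and y: "y \<in> carrier_vec d"
  shows "vnorm ((Ufirst U k)\<^sup>T *\<^sub>v y) \<le> vnorm y"
proof -
  have "U * U\<^sup>T = 1\<^sub>m d" by (rule mat_mult_left_right_inverse[OF _ U]) (use U in simp)
  then have iso: "vnorm (U\<^sup>T *\<^sub>v y) = vnorm y"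
    using U y by (intro vnorm_orthonormal_mult[of _ d d]) auto
  have "((Ufirst U k)\<^sup>T *\<^sub>v y) $ j = (U\<^sup>T *\<^sub>v y) $ j" if "j < k" for j
    using that \<open>k \<le> d\<close> U y by (auto simp: Ufirst_def scalar_prod_def)
  then have "vnorm ((Ufirst U k)\<^sup>T *\<^sub>v y) ^ 2 = (\<Sum>j<k. ((U\<^sup>T *\<^sub>v y) $ j)^2)"
    unfolding vnorm_square using U by (simp add: Ufirst_def)
  also have "\<dots> \<le> (\<Sum>j<d. ((U\<^sup>T *\<^sub>v y) $ j)^2)"
    using \<open>k \<le> d\<close> by (intro sum_mono2) auto
  also have "\<dots> = vnorm (U\<^sup>T *\<^sub>v y) ^ 2" unfolding vnorm_square using U by simp
  finally have "vnorm ((Ufirst U k)\<^sup>T *\<^sub>v y) ^ 2 \<le> vnorm y ^ 2" using iso by simp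
  then show ?thesis by (rule power2_le_imp_le) simp
qed

lemma cos_theta_Ufirst_eq_sigma_min:
  assumes U: "U \<in> carrier_mat d d" "U\<^sup>T * U = 1\<^sub>m d" and "1 \<le> k" "k \<le> d"
    and X: "X \<in> carrier_mat d k" "X\<^sup>T * X = 1\<^sub>m k"
  shows "cos_theta (Ufirst U k) X = sigma_min ((Ufirst U k)\<^sup>T * X)"
proof -
  let ?W = "(Ufirst U k)\<^sup>T * X" and ?e = "unit_vec k 0"
  have Uk: "Ufirst U k \<in> carrier_mat d k" using U by (simp add: Ufirst_def)
  have e: "?e \<in> carrier_vec k" "vnorm ?e = 1" using \<open>1 \<le> k\<close> by (auto simp: vnorm_def)
  have "sigma_min ?W = sigma_min ?W * vnorm ?e" using e by simp
  also have "\<dots> \<le> vnorm (?W *\<^sub>v ?e)" using Uk X e by (intro sigma_min_mult_vnorm_le) simp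
  also have "?W *\<^sub>v ?e = (Ufirst U k)\<^sup>T *\<^sub>v (X *\<^sub>v ?e)" using Uk X e by simp
  also have "vnorm \<dots> \<le> vnorm (X *\<^sub>v ?e)"
    using U X e \<open>k \<le> d\<close> by (intro vnorm_Ufirst_transpose_mult_le) auto
  also have "\<dots> = 1" using vnorm_orthonormal_mult[OF X e(1)] e by simp
  finally have "sigma_min ?W \<le> 1" .
  moreover have "sigma_min ?W \<ge> 0" using Uk X \<open>1 \<le> k\<close> by (intro sigma_min_nonneg[of _ k]) auto
  ultimately have "-1 \<le> sigma_min ?W" "sigma_min ?W \<le> 1" by linarith+
  then show ?thesis unfolding cos_theta_def by (rule cos_arccos)
qed

lemma Emat_carrier:
  assumes "L \<in> carrier_mat k k" and "Uk \<in> carrier_mat d k" and "Xi \<in> carrier_mat d k"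
  shows "Emat L Uk Xi X \<in> carrier_mat k k"
  using assms minv_carrier[of L] minv_carrier[of "Uk\<^sup>T * X"] unfolding Emat_def by auto

lemma spec_norm_Emat_le:
  assumes U: "U \<in> carrier_mat d d" "U\<^sup>T * U = 1\<^sub>m d" and "1 \<le> k" "k \<le> d"
    and L: "L \<in> carrier_mat k k" "spec_norm (minv L) \<le> 1 / l" and "l > 0" and "c \<ge> 0"
    and Xi: "Xi \<in> carrier_mat d k" and X: "X \<in> carrier_mat d k" "X\<^sup>T * X = 1\<^sub>m k"
    and pert: "spec_norm ((Ufirst U k)\<^sup>T * Xi) \<le> c * cos_theta (Ufirst U k) X"
  shows "spec_norm (Emat L (Ufirst U k) Xi X) \<le> c / l"
proof -
  let ?W = "(Ufirst U k)\<^sup>T * X"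
  have Uk: "Ufirst U k \<in> carrier_mat d k" using U by (simp add: Ufirst_def)
  have W: "?W \<in> carrier_mat k k" using Uk X by simp
  have "spec_norm (Emat L (Ufirst U k) Xi X)
      \<le> spec_norm (minv L) * spec_norm ((Ufirst U k)\<^sup>T * Xi) * spec_norm (minv ?W)"
    unfolding Emat_def using L(1) Uk Xi minv_carrier[of L] minv_carrier[of ?W]
    by (intro spec_norm_mult3_le[of _ k k _ k _ k]) auto
  also have "\<dots> \<le> (1 / l) * (c * sigma_min ?W) * spec_norm (minv ?W)"
    using L pert cos_theta_Ufirst_eq_sigma_min[OF U \<open>1 \<le> k\<close> \<open>k \<le> d\<close> X] \<open>l > 0\<close>
    by (intro mult_right_mono mult_mono) (auto simp: spec_norm_nonneg)
  also have "\<dots> = (c / l) * (sigma_min ?W * spec_norm (minv ?W))" by simp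
  also have "\<dots> \<le> c / l"
    using sigma_min_mult_spec_norm_minv_le[OF W \<open>1 \<le> k\<close>]
    by (rule mult_left_le) (use \<open>c \<ge> 0\<close> \<open>l > 0\<close> in simp)
  finally show ?thesis .
qed

lemma Gmat_Suc_scaled_one_plus:
  assumes "L \<in> carrier_mat k k" "Gmat \<beta> L E n \<in> carrier_mat k k" "E (Suc n) \<in> carrier_mat k k"
  shows "Gmat \<beta> L E (Suc n)
    = minv (1 \<cdot>\<^sub>m 1\<^sub>m k + ((- \<beta>) \<cdot>\<^sub>m (minv L * Gmat \<beta> L E n * minv L) + E (Suc n)))"
proof -
  have "1\<^sub>m k - \<beta> \<cdot>\<^sub>m B + F = 1 \<cdot>\<^sub>m 1\<^sub>m k + ((- \<beta>) \<cdot>\<^sub>m B + F)"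
    if "B \<in> carrier_mat k k" "F \<in> carrier_mat k k" for B F :: "real mat"
    using that by (intro eq_matI) auto
  moreover have "minv L * Gmat \<beta> L E n * minv L \<in> carrier_mat k k"
    using assms minv_carrier_mat[OF assms(1)] by simp
  ultimately show ?thesis using assms by simp
qed

lemma Gmat_invertible_norm_le:
  fixes L :: "real mat" and E :: "nat \<Rightarrow> real mat" and l \<delta> \<beta> :: real
  defines "r \<equiv> riccati_seq (l - \<delta>) \<beta> (l / 2 - \<delta>)"
  assumes L: "L \<in> carrier_mat k k" "spec_norm (minv L) \<le> 1 / l" and "l > 0" and "\<beta> \<ge> 0"
    and E: "\<And>n. E n \<in> carrier_mat k k" "\<And>n. spec_norm (E n) \<le> \<delta> / l"
    and r_pos: "\<And>n. r n > 0"
  shows "Gmat \<beta> L E n \<in> carrier_mat k k \<and> invertible_mat (Gmat \<beta> L E n)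
         \<and> spec_norm (Gmat \<beta> L E n) \<le> l / r n"
proof (induction n)
  case 0
  let ?M = "(1/2) \<cdot>\<^sub>m 1\<^sub>m k + E 0"
  have "\<delta> / l < 1/2" using r_pos[of 0] \<open>l > 0\<close> unfolding r_def by (simp add: field_simps)
  note M = invertible_scaled_one_plus[OF E(1)[of 0] E(2)[of 0] this]
  have M_carrier: "?M \<in> carrier_mat k k" using E(1)[of 0] by simp
  have "1 / (1/2 - \<delta> / l) = l / r 0" using \<open>l > 0\<close> unfolding r_def by (simp add: field_simps)
  then show ?case
    using M minv_minv(1)[OF M_carrier] minv_carrier[of ?M] M_carrier L(1) E(1)[of 0] by simp
next
  case (Suc n)
  let ?G = "Gmat \<beta> L E n"
  let ?B = "minv L * ?G * minv L"
  let ?P = "(- \<beta>) \<cdot>\<^sub>m ?B + E (Suc n)"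
  have Linv: "minv L \<in> carrier_mat k k" using minv_carrier[of L] L(1) by simp
  have G: "?G \<in> carrier_mat k k" "spec_norm ?G \<le> l / r n" using Suc by auto
  have B: "?B \<in> carrier_mat k k" using G Linv by simp
  have "spec_norm ?B \<le> spec_norm (minv L) * spec_norm ?G * spec_norm (minv L)"
    using Linv G by (intro spec_norm_mult3_le) auto
  also have "\<dots> \<le> (1 / l) * (l / r n) * (1 / l)"
    using L G \<open>l > 0\<close> r_pos[of n] by (intro mult_mono) (auto simp: spec_norm_nonneg)
  finally have "spec_norm ?B \<le> 1 / (l * r n)" using \<open>l > 0\<close> by (simp add: mult.commute)
  define p where "p = \<beta> * (1 / (l * r n)) + \<delta> / l"
  have P: "?P \<in> carrier_mat k k" using B E(1)[of "Suc n"] by simp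
  have "spec_norm ?P \<le> \<bar>- \<beta>\<bar> * spec_norm ?B + spec_norm (E (Suc n))"
    using spec_norm_add_le[of "(- \<beta>) \<cdot>\<^sub>m ?B" k k "E (Suc n)"] spec_norm_smult[of "- \<beta>" ?B]
      B E(1)[of "Suc n"] by simp
  also have "\<dots> \<le> p"
    unfolding p_def using \<open>\<beta> \<ge> 0\<close>
      add_mono[OF mult_left_mono[OF \<open>spec_norm ?B \<le> 1 / (l * r n)\<close> \<open>\<beta> \<ge> 0\<close>] E(2)[of "Suc n"]]
    by simp
  finally have P_norm: "spec_norm ?P \<le> p" .
  have "1 - p = r (Suc n) / l"
    using \<open>l > 0\<close> r_pos[of n] unfolding p_def r_def by (simp add: field_simps)
  moreover have "r (Suc n) / l > 0" using r_pos \<open>l > 0\<close> by simp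
  ultimately have "p < 1" by linarith
  note M = invertible_scaled_one_plus[OF P P_norm this]
  have "1 / (1 - p) = l / r (Suc n)" using \<open>1 - p = r (Suc n) / l\<close> by simp
  have "Gmat \<beta> L E (Suc n) = minv (1 \<cdot>\<^sub>m 1\<^sub>m k + ?P)"
    using Gmat_Suc_scaled_one_plus[OF L(1) G(1) E(1)] .
  moreover have "1 \<cdot>\<^sub>m 1\<^sub>m k + ?P \<in> carrier_mat k k" using P by simp
  ultimately show ?case
    using M \<open>1 / (1 - p) = l / r (Suc n)\<close> minv_minv(1) minv_carrier by (metis carrier_matD(1))
qed

lemma dim_row_Cmat [simp]: "dim_row (Cmat L G t) = dim_row L"
  by (cases t) simp_all

lemma Cmat_invertible:
  assumes L: "L \<in> carrier_mat k k" "invertible_mat L"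
    and G: "\<And>n. G n \<in> carrier_mat k k" "\<And>n. invertible_mat (G n)"
  shows "Cmat L G t \<in> carrier_mat k k \<and> invertible_mat (Cmat L G t)"
proof (induction t)
  case 0
  then show ?case using L invertible_matI[of "1\<^sub>m k" k "1\<^sub>m k"] by simp
next
  case (Suc t)
  have H: "minv (G t) \<in> carrier_mat k k" "invertible_mat (minv (G t))"
    using minv_carrier_mat G minv_minv(1)[OF G(1)[of t] G(2)[of t]] by auto
  have "L * minv (G t) \<in> carrier_mat k k" "invertible_mat (L * minv (G t))"
    using L H minv_mult(1)[OF L H] by auto
  then show ?case using Suc minv_mult(1)[of "L * minv (G t)" k "Cmat L G t"] by auto
qed

lemma minv_Cmat_Suc:
  assumes L: "L \<in> carrier_mat k k" "invertible_mat L"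
    and G: "\<And>n. G n \<in> carrier_mat k k" "\<And>n. invertible_mat (G n)"
  shows "minv (Cmat L G (Suc t)) = minv (Cmat L G t) * G t * minv L"
proof -
  let ?C = "Cmat L G t" and ?H = "minv (G t)"
  have C: "?C \<in> carrier_mat k k" "invertible_mat ?C" using Cmat_invertible[OF L G] by auto
  have H: "?H \<in> carrier_mat k k" "invertible_mat ?H" "minv ?H = G t"
    using minv_carrier_mat G minv_minv[OF G(1)[of t] G(2)[of t]] by auto
  have LH: "L * ?H \<in> carrier_mat k k" "invertible_mat (L * ?H)" using L H minv_mult(1)[of L k] by auto
  have "minv (Cmat L G (Suc t)) = minv ?C * minv (L * ?H)"
    using minv_mult(2)[OF LH C] by simp
  also have "\<dots> = minv ?C * (G t * minv L)" using minv_mult(2)[OF L H(1,2)] H(3) by simp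
  also have "\<dots> = minv ?C * G t * minv L"
    using minv_carrier[of ?C] minv_carrier[of L] C(1) L(1) G(1)[of t]
    by (simp add: assoc_mult_mat[of _ k k _ k _ k])
  finally show ?thesis .
qed

lemma spec_norm_Cmat_mult_minv_le:
  assumes L: "L \<in> carrier_mat k k" "invertible_mat L" "spec_norm (minv L) \<le> 1 / l" and "l > 0"
    and G: "\<And>n. G n \<in> carrier_mat k k" "\<And>n. invertible_mat (G n)" "\<And>n. spec_norm (G n) \<le> l / r n"
    and r: "\<And>n. r n > 0"
  shows "spec_norm (Cmat L G m * minv (Cmat L G (m + n))) \<le> 1 / (\<Prod>i\<in>{m..<m+n}. r i)"
proof (induction n)
  case 0
  then show ?case
    using Cmat_invertible[of L k G, OF L(1,2) G(1,2), where t = m] invertible_mat_minv(1)[of _ k] spec_norm_one_mat[of k]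
    by simp
next
  case (Suc n)
  let ?D = "Cmat L G m * minv (Cmat L G (m + n))"
  have C: "Cmat L G j \<in> carrier_mat k k" for j using Cmat_invertible[of L k G, OF L(1,2) G(1,2)] by blast
  have D: "?D \<in> carrier_mat k k" using C minv_carrier_mat[OF C] by (rule mult_carrier_mat)
  have Linv: "minv L \<in> carrier_mat k k" using minv_carrier[of L] L(1) by simp
  have Ci: "minv (Cmat L G (m + n)) \<in> carrier_mat k k" using minv_carrier_mat[OF C] .
  have "Cmat L G m * minv (Cmat L G (m + Suc n))
      = Cmat L G m * (minv (Cmat L G (m + n)) * G (m + n) * minv L)"
    using minv_Cmat_Suc[of L k G, OF L(1,2) G(1,2), where t = "m + n"] by simp
  also have "\<dots> = ?D * G (m + n) * minv L"
    by (simp only: assoc_mult_mat[OF C[of m] mult_carrier_mat[OF Ci G(1)] Linv, symmetric]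
        assoc_mult_mat[OF C[of m] Ci G(1), symmetric])
  also have "spec_norm \<dots> \<le> spec_norm ?D * spec_norm (G (m + n)) * spec_norm (minv L)"
    using D G(1) Linv by (intro spec_norm_mult3_le) auto
  also have "\<dots> \<le> (1 / (\<Prod>i\<in>{m..<m+n}. r i)) * (l / r (m + n)) * (1 / l)"
  proof -
    have P: "0 < (\<Prod>i\<in>{m..<m+n}. r i)" using r by (simp add: prod_pos)
    then have "0 \<le> l / ((\<Prod>i\<in>{m..<m+n}. r i) * r (m + n))" using \<open>l > 0\<close> r[of "m + n"] by simp
    then show ?thesis
      using Suc G(3) L(3) \<open>l > 0\<close> r P by (intro mult_mono) (auto simp: spec_norm_nonneg)
  qed
  also have "\<dots> = 1 / (\<Prod>i\<in>{m..<m + Suc n}. r i)" using \<open>l > 0\<close> by simp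
  finally show ?case .
qed

lemma spec_norm_Cmat_Gmat_le:
  fixes L :: "real mat" and E :: "nat \<Rightarrow> real mat"
  assumes L: "L \<in> carrier_mat k k" "invertible_mat L" "spec_norm (minv L) \<le> 1 / l"
    and \<beta>: "\<beta> > 0" "l > 2 * sqrt \<beta>"
    and E: "\<And>n. E n \<in> carrier_mat k k" "\<And>n. spec_norm (E n) \<le> 1/32 * (l - 2 * sqrt \<beta>) / l"
  defines "\<rho> \<equiv> (1 - 1/32) * ((l + sqrt (l^2 - 4 * \<beta>)) / 2) + 1/32 * sqrt \<beta>"
  shows "spec_norm (Cmat L (Gmat \<beta> L E) m * minv (Cmat L (Gmat \<beta> L E) (m + n))) \<le> (31/15) / \<rho> ^ n"
proof -
  define \<delta> where "\<delta> = (l - 2 * sqrt \<beta>) / 32"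
  define r where "r = riccati_seq (l - \<delta>) \<beta> (l / 2 - \<delta>)"
  have s: "sqrt \<beta> > 0" "sqrt \<beta> ^ 2 = \<beta>" using \<beta>(1) by simp_all
  have "l > 0" using \<beta> s by linarith
  note rate = anpm_rate_constants[OF s(1) \<beta>(2), unfolded s(2) \<delta>_def[symmetric] \<rho>_def[symmetric]]
  obtain x where x: "0 \<le> x" "x \<le> l - \<delta>" "x * (l - \<delta> - x) = \<beta>"
    and x_bound: "(l / 2 - \<delta>) - 15/31 * \<rho> \<ge> (1 - 15/31) * x"
    using anpm_rate_smaller_root[OF s(1) \<beta>(2), unfolded s(2) \<delta>_def[symmetric] \<rho>_def[symmetric]] .
  have r_pos: "r n > 0" for n
    using less_le_trans[OF rate(1) riccati_seq_ge[OF rate(1) _ rate(2)]] \<beta>(1) unfolding r_def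
    by simp
  have prod: "(\<Prod>i\<in>{m..<m+n}. r i) \<ge> 15/31 * \<rho> ^ n"
    unfolding r_def using \<beta>(1) rate(3)
    by (intro prod_riccati_seq_ge[OF rate(1,2) _ x _ rate(4) _ _ x_bound]) simp_all
  have "\<delta> / l = 1/32 * (l - 2 * sqrt \<beta>) / l" unfolding \<delta>_def by simp
  then have G: "Gmat \<beta> L E i \<in> carrier_mat k k \<and> invertible_mat (Gmat \<beta> L E i)
      \<and> spec_norm (Gmat \<beta> L E i) \<le> l / r i" for i
    unfolding r_def using L \<open>l > 0\<close> \<beta>(1) E r_pos[unfolded r_def]
    by (intro Gmat_invertible_norm_le) auto
  have "spec_norm (Cmat L (Gmat \<beta> L E) m * minv (Cmat L (Gmat \<beta> L E) (m + n)))
      \<le> 1 / (\<Prod>i\<in>{m..<m+n}. r i)"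
    using G L \<open>l > 0\<close> r_pos by (intro spec_norm_Cmat_mult_minv_le) auto
  also have "\<dots> \<le> 1 / (15/31 * \<rho> ^ n)"
  proof (rule divide_left_mono[OF prod])
    have "0 < (\<Prod>i\<in>{m..<m+n}. r i)" using r_pos by (simp add: prod_pos)
    then show "0 < (\<Prod>i\<in>{m..<m+n}. r i) * (15/31 * \<rho> ^ n)" using rate(3) by simp
  qed simp
  finally show ?thesis by simp
qed

lemma Lfirst_eq_mat_diag: "Lfirst lam k = mat_diag k (\<lambda>i. lam (i + 1))"
  unfolding Lfirst_def mat_diag_def by (rule eq_matI) auto

lemma Lrest_eq_mat_diag: "Lrest lam d k = mat_diag (d - k) (\<lambda>i. lam (k + 1 + i))"
  unfolding Lrest_def mat_diag_def by (rule eq_matI) auto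

lemma Lfirst_invertible:
  assumes "l > 0" and lam: "\<And>i. i < k \<Longrightarrow> l \<le> lam (i + 1)"
  shows "invertible_mat (Lfirst lam k)" and "spec_norm (minv (Lfirst lam k)) \<le> 1 / l"
proof -
  let ?D = "mat_diag k (\<lambda>i. 1 / lam (i + 1))"
  have "Lfirst lam k * ?D = mat_diag k (\<lambda>i. lam (i + 1) * (1 / lam (i + 1)))"
    unfolding Lfirst_eq_mat_diag by simp
  also have "\<dots> = 1\<^sub>m k"
  proof -
    have "lam (i + 1) \<noteq> 0" if "i < k" for i using less_le_trans[OF \<open>l > 0\<close> lam[OF that]] by simp
    then show ?thesis unfolding mat_diag_def by (intro eq_matI) auto
  qed
  finally have inv: "Lfirst lam k * ?D = 1\<^sub>m k" .
  have L: "Lfirst lam k \<in> carrier_mat k k" unfolding Lfirst_eq_mat_diag by simp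
  show "invertible_mat (Lfirst lam k)" using invertible_matI[OF L _ inv] by simp
  have "\<bar>1 / lam (i + 1)\<bar> \<le> 1 / l" if "i < k" for i
    using lam[OF that] \<open>l > 0\<close> by (simp add: frac_le)
  then have "spec_norm ?D \<le> 1 / l" using \<open>l > 0\<close> by (intro spec_norm_mat_diag_le) auto
  then show "spec_norm (minv (Lfirst lam k)) \<le> 1 / l" using minv_eqI[OF L _ inv] by simp
qed

lemma is_QR_orthonormal:
  "is_QR Y Q R \<Longrightarrow> Y \<in> carrier_mat m n \<Longrightarrow> Q \<in> carrier_mat m n \<and> Q\<^sup>T * Q = 1\<^sub>m n"
  unfolding is_QR_def by auto

lemma anpm_iterates_orthonormal:
  fixes X R Xi Y :: "nat \<Rightarrow> real mat"
  assumes X0: "X 0 \<in> carrier_mat d k" "(X 0)\<^sup>T * X 0 = 1\<^sub>m k" and Xi: "\<And>t. Xi t \<in> carrier_mat d k"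
    and QR1: "is_QR (Y0 + Xi 0) (X 1) (R 1)"
    and QRt: "\<And>t. t \<ge> 1 \<Longrightarrow> is_QR (Y t + Xi t) (X (t + 1)) (R (t + 1))"
  shows "X t \<in> carrier_mat d k \<and> (X t)\<^sup>T * X t = 1\<^sub>m k"
proof -
  have sum_carrier: "Z + Xi t \<in> carrier_mat d k" for Z t using Xi[of t] by (intro carrier_matI) auto
  consider "t = 0" | "t = 1" | "t \<ge> 2" by linarith
  then show ?thesis
  proof cases
    case 1
    then show ?thesis using X0 by simp
  next
    case 2
    then show ?thesis using is_QR_orthonormal[OF QR1 sum_carrier] by simp
  next
    case 3
    then have "is_QR (Y (t - 1) + Xi (t - 1)) (X t) (R t)" using QRt[of "t - 1"] by simp
    from is_QR_orthonormal[OF this sum_carrier] show ?thesis .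
  qed
qed

text \<open>The QR steps enter only through the orthonormality of the iterates.\<close>

theorem lemma5:
  fixes d k :: nat and eps beta :: real and lam :: "nat \<Rightarrow> real"
    and A U :: "real mat" and X R Xi :: "nat \<Rightarrow> real mat"
  assumes dk: "d > k" "k \<ge> 1"
    and eps: "0 < eps" "eps < 1"
    and A: "A \<in> carrier_mat d d" "A\<^sup>T = A"
    and U: "U \<in> carrier_mat d d" "U\<^sup>T * U = 1\<^sub>m d"
    and eig: "\<And>i. 1 \<le> i \<Longrightarrow> i \<le> d \<Longrightarrow> A *\<^sub>v col U (i - 1) = lam i \<cdot>\<^sub>v col U (i - 1)"
    and lam_sorted: "\<And>i j. 1 \<le> i \<Longrightarrow> i \<le> j \<Longrightarrow> j \<le> d \<Longrightarrow> lam j \<le> lam i"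
    and lam_nonneg: "lam d \<ge> 0"
    and gap: "lam k > lam (k + 1)"
    and beta: "beta > 0" "lam k > 2 * sqrt beta" "2 * sqrt beta \<ge> lam (k + 1)"
    and X0: "X 0 \<in> carrier_mat d k" "(X 0)\<^sup>T * X 0 = 1\<^sub>m k"
    and cos0: "cos_theta (Ufirst U k) (X 0) > 0"
    and Xi_dim: "\<And>t. Xi t \<in> carrier_mat d k"
    and QR1: "is_QR ((1/2) \<cdot>\<^sub>m (A * X 0) + Xi 0) (X 1) (R 1)"
    and QRt: "\<And>t. t \<ge> 1 \<Longrightarrow>
       is_QR (A * X t - beta \<cdot>\<^sub>m (X (t - 1) * minv (R t)) + Xi t) (X (t + 1)) (R (t + 1))"
    and pert1: "\<And>t. spec_norm ((Urest U k)\<^sup>T * Xi t) \<le> (1/32) * (lam k - 2 * sqrt beta) * eps"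
    and pert2: "\<And>t. spec_norm ((Ufirst U k)\<^sup>T * Xi t)
                    \<le> (1/32) * (lam k - 2 * sqrt beta) * cos_theta (Ufirst U k) (X t)"
  shows "\<forall>t \<ge> 1. \<forall>s < t.
     (let c = (1/32::real); c1 = (31/15::real);
          lamp = (lam k + sqrt (lam k ^ 2 - 4 * beta)) / 2;
          L = Lfirst lam k;
          G = Gmat beta L (\<lambda>t. Emat L (Ufirst U k) (Xi t) (X t));
          C = Cmat L G
      in spec_norm (minv (C t)) \<le> c1 / ((1 - c) * lamp + c * sqrt beta) ^ t
       \<and> spec_norm (C (t - 1 - s) * minv (C t)) \<le> c1 / ((1 - c) * lamp + c * sqrt beta) ^ (s + 1)
       \<and> spec_norm (pmat beta (Lrest lam d k) t) \<le> sqrt beta ^ t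
       \<and> spec_norm (qmat beta (Lrest lam d k) t) \<le> real (t + 1) * sqrt beta ^ t)"
proof -
  define L E where "L = Lfirst lam k" and "E = (\<lambda>t. Emat L (Ufirst U k) (Xi t) (X t))"
  define C where "C = Cmat L (Gmat beta L E)"
  have "0 < lam k" using beta(1,2) real_sqrt_ge_zero[of beta] by linarith
  then have L: "L \<in> carrier_mat k k" "invertible_mat L" "spec_norm (minv L) \<le> 1 / lam k"
    using Lfirst_invertible[of "lam k" k lam] lam_sorted[of _ k] dk
    unfolding L_def Lfirst_eq_mat_diag by auto
  have "0 \<le> 1/32 * (lam k - 2 * sqrt beta)" using beta(2) by simp
  then have E: "E n \<in> carrier_mat k k" "spec_norm (E n) \<le> 1/32 * (lam k - 2 * sqrt beta) / lam k" for n
    using Emat_carrier[OF L(1) _ Xi_dim] U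
      spec_norm_Emat_le[OF U dk(2) less_imp_le[OF dk(1)] L(1,3) \<open>0 < lam k\<close> _ Xi_dim _ _ pert2]
      anpm_iterates_orthonormal[OF X0 Xi_dim QR1 QRt]
    unfolding E_def by (auto simp: Ufirst_def)
  define \<rho> where "\<rho> = (1 - 1/32) * ((lam k + sqrt (lam k ^ 2 - 4 * beta)) / 2) + 1/32 * sqrt beta"
  note C_bound = spec_norm_Cmat_Gmat_le[where L = L and E = E and l = "lam k" and \<beta> = beta,
      OF L beta(1,2) E, folded C_def \<rho>_def]
  have "C 0 * minv (C t) = minv (C t)" for t
    using L(1) minv_carrier[of "C t"] unfolding C_def by simp
  then have C_first: "spec_norm (minv (C t)) \<le> 31/15 / \<rho> ^ t" for t
    using C_bound[of 0 t] by simp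
  have C_shift: "spec_norm (C (t - 1 - s) * minv (C t)) \<le> 31/15 / \<rho> ^ (s + 1)" if "s < t" for s t
    using C_bound[of "t - 1 - s" "s + 1"] that by simp
  have Lrest: "0 \<le> lam (k + 1 + i) \<and> lam (k + 1 + i) \<le> 2 * sqrt beta" if "i < d - k" for i
  proof -
    have "k + 1 + i \<le> d" using that by linarith
    then have "lam d \<le> lam (k + 1 + i)" "lam (k + 1 + i) \<le> lam (k + 1)"
      using lam_sorted[of "k + 1 + i" d] lam_sorted[of "k + 1" "k + 1 + i"] by simp_all
    then show ?thesis using lam_nonneg beta(3) by linarith
  qed
  show ?thesis
    unfolding Let_def L_def[symmetric] E_def[symmetric] C_def[symmetric] \<rho>_def[symmetric]
      Lrest_eq_mat_diag
    by (intro allI impI conjI C_first C_shift spec_norm_pmat_mat_diag_le[OF beta(1) Lrest]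
        spec_norm_qmat_mat_diag_le[OF beta(1) Lrest])
qed

end
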